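(* Let $q>2$ be a prime power and let $G$ be a tree with $s\geq 2$ vertices. The weight distribution of $\mathcal{C}_G$ satisfies $$A_{\sum_{i=0}^{r-1}(-1)^i(q-1)^{s-i}}(\mathcal{C}_G)=\binom{s-1}{r}(q-1)^r\quad\text{for every } r\in\{1,2,\dots,s-1\},$$ and $A_j(\mathcal{C}_G)=0$ for the remaining values of $j$. Consequently, the minimum distance is given by $\delta(\mathcal{C}_G)=(q-1)^{s-1}(q-2)$, and it corresponds to $r=2$, that is, it is achieved with all polynomials (in $KE(G)$) with two non-zero terms.
   Context: $K=\mathbb{F}_q$ is the finite field with $q$ elements and $\mathbb{F}_q^*=\mathbb{F}_q\setminus\{0\}$. For a finite simple graph $G$ on vertex set $\{t_1,\dots,t_s\}$ with edge set $E$, the vertices are also regarded as variables and $KE(G)=\mathrm{span}_K\{t_it_j : \{t_i,t_j\}\in E\}\subseteq K[t_1,\dots,t_s]$. A tree is a connected graph containing no cycles. The number of non-zero terms of $f\in KE(G)$ is the number of edge monomials having non-zero coefficient in $f$. Put $T=(\mathbb{F}_q^* )^s=\{P_1,\dots,P_{|T|}\}$, $|T|=(q-1)^s$. The edge code of $G$ is $\mathcal{C}_G=\{(f(P_1),\dots,f(P_{|T|})): f\in KE(G)\}\subseteq K^{|T|}$. The Hamming weight of a codeword is its number of non-zero coordinates; $A_i(\mathcal{C}_G)$ is the number of codewords of Hamming weight $i$ ($1\le i\le |T|$), the weight distribution is $(A_1(\mathcal{C}_G),\dots,A_{|T|}(\mathcal{C}_G))$, and the minimum distance $\delta(\mathcal{C}_G)$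 is the smallest $i$ with $A_i(\mathcal{C}_G)\neq 0$.
   Formalization: The minimum-distance formula and its identification with r=2 are stated only for s≥3; for s=2 every non-zero codeword has weight (q-1)^2, so the claimed value (q-1)(q-2) is false there. *)

theory Defs
  imports
    "HOL-Library.Poly_Mapping"
    "HOL-Library.FuncSet"
    "HOL-Library.Cardinality"
    "Graph_Theory.Graph_Theory"
begin

text \<open>
  A simple graph is a finite symmetric loop-free digraph without parallel arcs, so that
  the edge \<open>{u, v}\<close> is present as the two arcs \<open>(u, v)\<close> and \<open>(v, u)\<close>. With this encoding
  \<open>pre_digraph.cycle\<close> also accepts walking an edge forth and back, hence \<open>Digraph_Component.tree\<close>
  is not the notion of a tree for undirected graphs. The closed walks of length at least 3
  satisfying \<open>pre_digraph.cycle\<close> are exactly the cycles of the undirected graph.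
\<close>

definition tree_graph :: "'v pair_pre_digraph \<Rightarrow> bool" where
  "tree_graph G \<longleftrightarrow> pair_graph G \<and> connected (with_proj G) \<and>
     \<not> (\<exists>p. pre_digraph.cycle (with_proj G) p \<and> 3 \<le> length p)"

text \<open>
  Polynomials over \<open>'k\<close> whose variables are the elements of \<open>'v\<close>: finitely supported maps from
  exponent vectors to coefficients.
\<close>

type_synonym ('v, 'k) mpoly = "('v \<Rightarrow>\<^sub>0 nat) \<Rightarrow>\<^sub>0 'k"

definition mpoly_scale :: "'k::field \<Rightarrow> ('v, 'k) mpoly \<Rightarrow> ('v, 'k) mpoly" where
  "mpoly_scale c f = Poly_Mapping.single 0 c * f"

lemma vector_space_mpoly_scale: "vector_space mpoly_scale"
  by standard (simp_all add: mpoly_scale_def algebra_simps single_add mult_single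
      flip: mult.assoc)

definition mpoly_eval :: "('v, 'k::field) mpoly \<Rightarrow> ('v \<Rightarrow> 'k) \<Rightarrow> 'k" where
  "mpoly_eval f P =
     (\<Sum>m\<in>Poly_Mapping.keys f. Poly_Mapping.lookup f m *
       (\<Prod>x\<in>Poly_Mapping.keys m. P x ^ Poly_Mapping.lookup m x))"

definition edge_exponent :: "'v \<times> 'v \<Rightarrow> ('v \<Rightarrow>\<^sub>0 nat)" where
  "edge_exponent e = Poly_Mapping.single (fst e) 1 + Poly_Mapping.single (snd e) 1"

definition edge_monomial :: "'v \<times> 'v \<Rightarrow> ('v, 'k::field) mpoly" where
  "edge_monomial e = Poly_Mapping.single (edge_exponent e) 1"

text \<open>
  Both arcs \<open>(u, v)\<close> and \<open>(v, u)\<close> of an edge have the same exponent vector and hence give the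
  same monomial.
\<close>

definition edge_space :: "'v pair_pre_digraph \<Rightarrow> ('v, 'k::field) mpoly set" where
  "edge_space G = module.span mpoly_scale (edge_monomial ` parcs G)"

definition num_terms :: "'v pair_pre_digraph \<Rightarrow> ('v, 'k::field) mpoly \<Rightarrow> nat" where
  "num_terms G f = card {m \<in> edge_exponent ` parcs G. Poly_Mapping.lookup f m \<noteq> 0}"

definition torus :: "'v pair_pre_digraph \<Rightarrow> ('v \<Rightarrow> 'k::field) set" where
  "torus G = (pverts G \<rightarrow>\<^sub>E (UNIV - {0}))"

text \<open>
  Words of length \<open>n\<close> are lists of length \<open>n\<close>. The list \<open>Ps\<close> is meant to enumerate the points
  of the torus without repetition.
\<close>

definition evaluation_word :: "('v \<Rightarrow> 'k) list \<Rightarrow> ('v, 'k::field) mpoly \<Rightarrow> 'k list" where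
  "evaluation_word Ps f = map (mpoly_eval f) Ps"

definition edge_code :: "'v pair_pre_digraph \<Rightarrow> ('v \<Rightarrow> 'k::field) list \<Rightarrow> 'k list set" where
  "edge_code G Ps = evaluation_word Ps ` edge_space G"

definition hamming_weight :: "'k::zero list \<Rightarrow> nat" where
  "hamming_weight c = card {i. i < length c \<and> c ! i \<noteq> 0}"

definition weight_count :: "'k::zero list set \<Rightarrow> nat \<Rightarrow> nat" where
  "weight_count C i = card {c \<in> C. hamming_weight c = i}"

text \<open>The weight 0 of the zero word is excluded.\<close>

definition min_distance :: "'k::zero list set \<Rightarrow> nat" where
  "min_distance C = (LEAST i. 1 \<le> i \<and> weight_count C i \<noteq> 0)"

end

theory Submission
  imports Defs
begin

text \<open>
  Let \<open>f\<close> be a polynomial in \<open>KE(G)\<close> and write \<open>Q = q - 1\<close>. The value of \<open>f\<close> at a point of the torus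
  depends only on the vector of values of the \<open>s - 1\<close> edge monomials, and it is a linear form in
  this vector. When \<open>G\<close> is a tree, these vectors are equidistributed: every vector of non-zero
  values is attained at exactly \<open>Q\<close> points of the torus, because the tree can be built from a single
  vertex by attaching leaves, and the edge to a new leaf determines the coordinate at that leaf
  (\<open>grown_unique_neighbour\<close>, \<open>card_monomial_fibre\<close>).

  The weight of the codeword of \<open>f\<close> is therefore \<open>Q\<close> times the number of points of \<open>(K\<^sup>*)\<^bsup>s-1\<^esup>\<close> where a
  linear form with \<open>r\<close> non-zero coefficients does not vanish, \<open>r\<close> being the number of terms of \<open>f\<close>.
  Solving for one variable gives a recursion for this number in \<open>r\<close>, whose solution is the
  alternating sum of the theorem (\<open>card_nonzero_linear_form\<close>, \<open>card_nonvanishing\<close>).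

  So the weight depends on the number of terms alone. For \<open>q > 2\<close> different numbers of terms give
  different weights (\<open>inj_on_alt_sum\<close>). Hence only the zero polynomial has weight 0, evaluation
  is injective on \<open>KE(G)\<close>, and the codewords of the \<open>r\<close>-th weight are as many as the polynomials
  with \<open>r\<close> terms, namely \<open>(s - 1 choose r) Q\<^sup>r\<close>. Among the weights with \<open>r \<ge> 1\<close> the smallest is
  the one for \<open>r = 2\<close> (\<open>alt_sum_two_le\<close>).
\<close>

section \<open>Building a tree leaf by leaf\<close>

text \<open>
  Growth by attaching neighbours one at a time replaces induction over subtrees: in a tree each
  attached vertex is a leaf of the subgraph induced by the new vertex set.
\<close>

inductive grown :: "'v pair_pre_digraph \<Rightarrow> 'v set \<Rightarrow> bool" for G where
  root: "r \<in> pverts G \<Longrightarrow> grown G {r}"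
| leaf: "grown G S \<Longrightarrow> u \<in> S \<Longrightarrow> v \<notin> S \<Longrightarrow> (u, v) \<in> parcs G \<Longrightarrow> grown G (insert v S)"

lemma grown_subset_pverts:
  assumes "pair_graph G" and "grown G S"
  shows "S \<subseteq> pverts G"
proof -
  interpret pair_graph G by fact
  show ?thesis
    using assms(2) by (induction rule: grown.induct) (auto dest: wellformed'(2))
qed

lemma grown_walk:
  assumes "pair_graph G" and "grown G S" and "a \<in> S" and "b \<in> S"
  shows "\<exists>p. pre_digraph.awalk (with_proj G) a p b \<and> set (pawalk_verts a p) \<subseteq> S"
proof -
  interpret pair_graph G by fact
  show ?thesis
    using assms(2-)
  proof (induction arbitrary: a b rule: grown.induct)
    case (root r)
    then have "awalk a [] b \<and> set (pawalk_verts a []) \<subseteq> {r}"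
      by (simp add: awalk_Nil_iff)
    then show ?case by blast
  next
    case (leaf S u v)
    have vu: "(v, u) \<in> parcs G"
      using leaf.hyps by (blast intro: arcs_symmetric)
    have v: "v \<in> pverts G"
      using leaf.hyps wellformed' by blast
    consider "a \<in> S" "b \<in> S" | "a \<in> S" "b = v" | "a = v" "b \<in> S" | "a = v" "b = v"
      using leaf.prems by blast
    then show ?case
    proof cases
      case 1
      then show ?thesis using leaf.IH by blast
    next
      case 2
      then obtain p where p: "awalk a p u" "set (pawalk_verts a p) \<subseteq> S"
        using leaf.IH leaf.hyps by blast
      have "awalk u [(u, v)] v"
        using leaf.hyps v by (simp add: awalk_simps)
      then have "awalk a (p @ [(u, v)]) v"
        using p(1) awalk_appendI by blast
      moreover have "set (pawalk_verts a (p @ [(u, v)])) \<subseteq> insert v S"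
        using p awalk_verts_append[OF calculation] leaf.hyps by auto
      ultimately show ?thesis using 2 by blast
    next
      case 3
      then obtain p where p: "awalk u p b" "set (pawalk_verts u p) \<subseteq> S"
        using leaf.IH leaf.hyps by blast
      then have "awalk v ((v, u) # p) b" "set (pawalk_verts v ((v, u) # p)) \<subseteq> insert v S"
        using vu by (auto simp: awalk_Cons_iff)
      then show ?thesis using 3 by blast
    next
      case 4
      then have "awalk a [] b \<and> set (pawalk_verts a []) \<subseteq> insert v S"
        using v by (simp add: awalk_Nil_iff)
      then show ?thesis by blast
    qed
  qed
qed

text \<open>
  This is where acyclicity enters. Two distinct neighbours of \<open>v\<close> in \<open>S\<close> are joined by a path
  inside \<open>S\<close>, and closing that path through \<open>v\<close> gives a cycle of length at least 3.
\<close>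

lemma grown_unique_neighbour:
  assumes "tree_graph G" and "grown G S" and "v \<notin> S"
    and "u \<in> S" and "(u, v) \<in> parcs G" and "w \<in> S" and "(w, v) \<in> parcs G"
  shows "w = u"
proof (rule ccontr)
  assume "w \<noteq> u"
  interpret pair_graph G using assms(1) by (simp add: tree_graph_def)
  obtain p0 where p0: "awalk u p0 w" "set (pawalk_verts u p0) \<subseteq> S"
    using grown_walk[of G S u w] assms pair_graph by blast
  define p where "p = awalk_to_apath p0"
  have p: "apath u p w"
    unfolding p_def using p0(1) by (rule apath_awalk_to_apath)
  have "set p \<subseteq> set p0"
    unfolding p_def using p0(1) by (rule awalk_to_apath_subset)
  then have "{u} \<union> set (map fst p) \<union> set (map snd p) \<subseteq> {u} \<union> set (map fst p0) \<union> set (map snd p0)"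
    by auto
  then have pS: "set (pawalk_verts u p) \<subseteq> S"
    using p0(2) unfolding set_awalk_verts[OF awalkI_apath[OF p]] set_awalk_verts[OF p0(1)]
    by (rule subset_trans)
  have "p \<noteq> []"
    using p \<open>w \<noteq> u\<close> by (auto simp: apath_Nil_iff)
  have walk: "awalk u (p @ [(w, v), (v, u)]) u"
  proof (rule awalk_appendI)
    show "awalk u p w" using p by (rule awalkI_apath)
    show "awalk w [(w, v), (v, u)] u"
      using assms arcs_symmetric wellformed' by (fastforce simp: awalk_simps)
  qed
  have verts: "pawalk_verts u (p @ [(w, v), (v, u)]) = pawalk_verts u p @ [v, u]"
    using awalk_verts_append[OF walk] by simp
  have hd: "pawalk_verts u p = u # tl (pawalk_verts u p)"
    using p \<open>p \<noteq> []\<close> by (cases p) (auto simp: apath_Cons_iff)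
  have "distinct (pawalk_verts u p)"
    using p by (simp add: apath_def)
  then have "distinct (u # tl (pawalk_verts u p))"
    using hd by simp
  moreover have "v \<notin> set (u # tl (pawalk_verts u p))"
    using pS hd assms(3) by (metis subsetD)
  ultimately have "distinct (tl (pawalk_verts u p) @ [v, u])"
    by auto
  then have "distinct (tl (pawalk_verts u (p @ [(w, v), (v, u)])))"
    unfolding verts using hd by (metis append_Cons list.sel(3))
  then have "cycle (p @ [(w, v), (v, u)])"
    unfolding cycle_def using walk by auto
  moreover have "3 \<le> length (p @ [(w, v), (v, u)])"
    using \<open>p \<noteq> []\<close> by (cases p) auto
  ultimately show False
    using assms(1) unfolding tree_graph_def by blast
qed

text \<open>
  A maximal grown set is everything: a walk from it to a vertex outside would contain an arc
  leaving it, along which it could be enlarged.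
\<close>

lemma grown_pverts:
  assumes "pair_graph G" and "connected (with_proj G)"
  shows "grown G (pverts G)"
proof -
  interpret pair_graph G by fact
  have reach: "a \<rightarrow>\<^sup>*\<^bsub>with_proj G\<^esub> b" if "a \<in> pverts G" "b \<in> pverts G" for a b
    using assms(2) that reachable_mk_symmetric_eq
    by (auto simp: connected_def strongly_connected_def)
  obtain r where r: "r \<in> pverts G"
    using assms(2) by (auto simp: connected_def strongly_connected_def mk_symmetric_def)
  have fin: "finite {S. grown G S}"
    by (rule finite_subset[of _ "Pow (pverts G)"])
      (use assms(1) grown_subset_pverts pair_finite_verts in auto)
  obtain S where S: "grown G S" and max: "\<And>S'. grown G S' \<Longrightarrow> S \<subseteq> S' \<Longrightarrow> S' = S"
    using finite_has_maximal[OF fin] r grown.root by (metis empty_Collect_eq mem_Collect_eq)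
  obtain a where a: "a \<in> S"
    using S by (cases rule: grown.cases) auto
  have "b \<in> S" if "b \<in> pverts G" for b
  proof -
    have "a \<rightarrow>\<^sup>*\<^bsub>with_proj G\<^esub> b"
      using reach a that S grown_subset_pverts assms(1) by blast
    then show ?thesis
    proof (induction rule: reachable_induct)
      case base
      then show ?case using a by simp
    next
      case (step x y)
      show ?case
        using max[OF grown.leaf[OF S step.IH, of y]] step.hyps by auto
    qed
  qed
  then have "S = pverts G"
    using S grown_subset_pverts assms(1) by blast
  then show ?thesis using S by simp
qed

section \<open>Values of the edge monomials on the torus\<close>

definition monomial_value :: "('v \<Rightarrow> 'k::field) \<Rightarrow> ('v \<Rightarrow>\<^sub>0 nat) \<Rightarrow> 'k" where
  "monomial_value P m = (\<Prod>x\<in>Poly_Mapping.keys m. P x ^ Poly_Mapping.lookup m x)"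

lemma lookup_edge_exponent:
  "Poly_Mapping.lookup (edge_exponent (u, v)) x = (if x = u then 1 else 0) + (if x = v then 1 else 0)"
  by (simp add: edge_exponent_def lookup_add lookup_single when_def)

lemma keys_edge_exponent: "Poly_Mapping.keys (edge_exponent (u, v)) = {u, v}"
  by (auto simp: in_keys_iff lookup_edge_exponent split: if_splits)

lemma edge_exponent_commute: "edge_exponent (u, v) = edge_exponent (v, u)"
  by (simp add: edge_exponent_def add.commute)

lemma monomial_value_edge_exponent:
  assumes "u \<noteq> v"
  shows "monomial_value P (edge_exponent (u, v)) = P u * P v"
  using assms by (simp add: monomial_value_def keys_edge_exponent lookup_edge_exponent)

lemma monomial_value_cong:
  assumes "\<And>x. x \<in> Poly_Mapping.keys m \<Longrightarrow> P x = P' x"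
  shows "monomial_value P m = monomial_value P' m"
  unfolding monomial_value_def using assms by (intro prod.cong) auto

text \<open>
  An edge is represented by its exponent vector, which its two arcs share, so that each edge is
  counted once.
\<close>

definition edges_within :: "'v pair_pre_digraph \<Rightarrow> 'v set \<Rightarrow> ('v \<Rightarrow>\<^sub>0 nat) set" where
  "edges_within G S = edge_exponent ` {e \<in> parcs G. fst e \<in> S \<and> snd e \<in> S}"

lemma keys_edges_within:
  assumes "m \<in> edges_within G S"
  shows "Poly_Mapping.keys m \<subseteq> S"
  using assms by (auto simp: edges_within_def keys_edge_exponent)

lemma edges_within_pverts:
  assumes "pair_graph G"
  shows "edges_within G (pverts G) = edge_exponent ` parcs G"
proof -
  interpret pair_graph G by fact
  show ?thesis
    unfolding edges_within_def using wellformed' by (intro arg_cong[of _ _ "image _"]) auto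
qed

lemma edges_within_singleton:
  assumes "pair_graph G"
  shows "edges_within G {r} = {}"
proof -
  interpret pair_graph G by fact
  show ?thesis
    using no_loops' by (auto simp: edges_within_def)
qed

text \<open>
  An arc between \<open>v\<close> and \<open>S\<close> avoiding \<open>u\<close> would give \<open>v\<close> a second neighbour in \<open>S\<close>.
\<close>

lemma edges_within_insert:
  assumes "tree_graph G" and "grown G S" and "u \<in> S" and "v \<notin> S" and "(u, v) \<in> parcs G"
  shows "edges_within G (insert v S) = insert (edge_exponent (u, v)) (edges_within G S)"
proof -
  interpret pair_graph G
    using assms(1) by (simp add: tree_graph_def)
  have nb: "w = u" if "w \<in> S" "(w, v) \<in> parcs G" for w
    using grown_unique_neighbour[OF assms(1,2,4,3,5)] that by blast
  have "edge_exponent (a, b) \<in> insert (edge_exponent (u, v)) (edges_within G S)"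
    if ab: "(a, b) \<in> parcs G" "a \<in> insert v S" "b \<in> insert v S" for a b
  proof -
    have "a \<noteq> b"
      using ab no_loops' by blast
    then consider "a \<in> S" "b \<in> S" | "a \<in> S" "b = v" | "a = v" "b \<in> S"
      using ab by blast
    then show ?thesis
    proof cases
      case 1
      then show ?thesis using ab by (auto simp: edges_within_def)
    next
      case 2
      then show ?thesis using nb ab by auto
    next
      case 3
      then have "b = u"
        using nb ab arcs_symmetric by blast
      then show ?thesis using 3 edge_exponent_commute by auto
    qed
  qed
  then show ?thesis
    using assms by (fastforce simp: edges_within_def)
qed

lemma edges_within_fresh:
  assumes "v \<notin> S"
  shows "edge_exponent (u, v) \<notin> edges_within G S"
  using keys_edges_within[of "edge_exponent (u, v)" G S] assms by (auto simp: keys_edge_exponent)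

lemma card_edges_within:
  assumes "tree_graph G" and "grown G S"
  shows "finite S \<and> finite (edges_within G S) \<and> Suc (card (edges_within G S)) = card S"
  using assms(2)
proof (induction rule: grown.induct)
  case (root r)
  then show ?case
    using assms(1) by (simp add: edges_within_singleton tree_graph_def)
next
  case (leaf S u v)
  then show ?case
    using edges_within_insert[OF assms(1), of S u v] edges_within_fresh[of v S u G] by simp
qed

text \<open>
  Prescribing arbitrary non-zero values for all edge monomials leaves \<open>q - 1\<close> points: the
  coordinate at the first vertex is free, and the coordinate at each attached leaf \<open>v\<close> is then
  forced to be the prescribed value of \<open>t\<^sub>u t\<^sub>v\<close> divided by the coordinate at its neighbour \<open>u\<close>.
\<close>

lemma card_monomial_fibre:
  fixes y :: "('v \<Rightarrow>\<^sub>0 nat) \<Rightarrow> 'k::{field,finite}"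
  assumes "tree_graph G" and "grown G S" and "\<And>m. m \<in> edges_within G S \<Longrightarrow> y m \<noteq> 0"
  shows "card {P \<in> S \<rightarrow>\<^sub>E (UNIV - {0}). \<forall>m\<in>edges_within G S. monomial_value P m = y m}
       = CARD('k) - 1"
  using assms(2,3)
proof (induction rule: grown.induct)
  case (root r)
  then show ?case
    using assms(1) by (simp add: edges_within_singleton tree_graph_def card_PiE card_Diff_subset)
next
  case (leaf S u v)
  let ?U = "UNIV - {0 :: 'k}" and ?m = "edge_exponent (u, v)"
  define A where "A = {P \<in> S \<rightarrow>\<^sub>E ?U. \<forall>m\<in>edges_within G S. monomial_value P m = y m}"
  define B where "B = {P \<in> insert v S \<rightarrow>\<^sub>E ?U.
    \<forall>m\<in>edges_within G (insert v S). monomial_value P m = y m}"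
  have ins: "edges_within G (insert v S) = insert ?m (edges_within G S)"
    using edges_within_insert[OF assms(1)] leaf.hyps by blast
  have "u \<noteq> v"
    using leaf.hyps by blast
  have y: "y ?m \<noteq> 0"
    using leaf.prems ins by blast
  have mv: "monomial_value P ?m = P u * P v" for P :: "'v \<Rightarrow> 'k"
    by (rule monomial_value_edge_exponent[OF \<open>u \<noteq> v\<close>])
  have upd: "monomial_value (P(v := t)) m = monomial_value P m"
    if "m \<in> edges_within G S" for m t and P :: "'v \<Rightarrow> 'k"
    using keys_edges_within[OF that] leaf.hyps by (intro monomial_value_cong) auto
  have "bij_betw (\<lambda>P. P(v := y ?m / P u)) A B"
  proof (rule bij_betw_byWitness[where f' = "\<lambda>P. P(v := undefined)"])
    show "\<forall>P\<in>A. (P(v := y ?m / P u))(v := undefined) = P"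
      using leaf.hyps by (auto simp: A_def PiE_def extensional_def fun_eq_iff)
    show "\<forall>P\<in>B. (P(v := undefined))(v := y ?m / (P(v := undefined)) u) = P"
    proof
      fix P assume "P \<in> B"
      then have "P u * P v = y ?m" "P u \<noteq> 0"
        using leaf.hyps by (auto simp: B_def ins mv PiE_def Pi_def)
      then have "P v = y ?m / P u"
        by (simp add: field_simps)
      then show "(P(v := undefined))(v := y ?m / (P(v := undefined)) u) = P"
        using \<open>u \<noteq> v\<close> by auto
    qed
    show "(\<lambda>P. P(v := y ?m / P u)) ` A \<subseteq> B"
    proof safe
      fix P assume P: "P \<in> A"
      then have "P u \<noteq> 0"
        using leaf.hyps by (auto simp: A_def PiE_def Pi_def)
      then show "P(v := y ?m / P u) \<in> B"
        using P y \<open>u \<noteq> v\<close> by (auto simp: A_def B_def ins mv upd PiE_def extensional_def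
            split: if_splits)
    qed
    show "(\<lambda>P. P(v := undefined)) ` B \<subseteq> A"
      using leaf.hyps by (auto simp: A_def B_def ins upd PiE_def extensional_def split: if_splits)
  qed
  then have "card B = card A"
    using bij_betw_same_card by metis
  also have "card A = CARD('k) - 1"
    unfolding A_def using leaf.prems ins by (intro leaf.IH) auto
  finally show ?case
    by (simp only: B_def)
qed

lemma tree_card_edges:
  assumes "tree_graph G"
  shows "finite (pverts G)" and "finite (edge_exponent ` parcs G)"
    and "Suc (card (edge_exponent ` parcs G)) = card (pverts G)"
proof -
  have G: "pair_graph G" "connected (with_proj G)"
    using assms by (auto simp: tree_graph_def)
  show "finite (pverts G)" and "finite (edge_exponent ` parcs G)"
    and "Suc (card (edge_exponent ` parcs G)) = card (pverts G)"
    using card_edges_within[OF assms grown_pverts[OF G]] unfolding edges_within_pverts[OF G(1)]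
    by blast+
qed

section \<open>Alternating sums and linear forms on the torus\<close>

text \<open>
  With \<open>Q = q - 1\<close> this is the number of points of \<open>(K\<^sup>*)\<^sup>n\<close> off the zero set of a linear form with
  \<open>r\<close> non-zero coefficients, and with \<open>n = s\<close> it is the weight in the theorem.
\<close>

definition alt_sum :: "int \<Rightarrow> nat \<Rightarrow> nat \<Rightarrow> int" where
  "alt_sum Q n r = (\<Sum>i<r. (-1) ^ i * Q ^ (n - i))"

lemma alt_sum_0 [simp]: "alt_sum Q n 0 = 0"
  by (simp add: alt_sum_def)

lemma alt_sum_Suc:
  assumes "r \<le> n"
  shows "alt_sum Q (Suc n) r = Q * alt_sum Q n r"
  unfolding alt_sum_def sum_distrib_left
  by (rule sum.cong) (use assms in \<open>auto simp: Suc_diff_le\<close>)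

lemma alt_sum_Suc_Suc: "alt_sum Q (Suc n) (Suc r) = Q ^ Suc n - alt_sum Q n r"
  unfolding alt_sum_def sum.lessThan_Suc_shift by (simp add: sum_negf)

text \<open>
  The geometric series. For \<open>Q \<ge> 2\<close> the term \<open>(-1)\<^sup>r Q\<^bsup>n+1-r\<^esup>\<close> determines \<open>r\<close> already by its absolute
  value, and over \<open>r \<ge> 1\<close> it is largest at \<open>r = 2\<close>, so this form decides both which of the sums
  coincide and which one is smallest.
\<close>

lemma alt_sum_closed_form:
  assumes "r \<le> n"
  shows "(Q + 1) * alt_sum Q n r = Q ^ Suc n - (-1) ^ r * Q ^ (Suc n - r)"
  using assms
proof (induction r)
  case 0
  then show ?case by (simp add: alt_sum_def)
next
  case (Suc r)
  then have e: "Suc n - r = Suc (n - r)" by simp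
  have "(Q + 1) * alt_sum Q n (Suc r)
      = (Q + 1) * alt_sum Q n r + (Q + 1) * ((-1) ^ r * Q ^ (n - r))"
    by (simp add: alt_sum_def algebra_simps)
  also have "\<dots> = Q ^ Suc n - (-1) ^ Suc r * Q ^ (n - r)"
    using Suc by (simp add: e algebra_simps)
  finally show ?case by simp
qed

lemma inj_on_alt_sum:
  assumes "Q \<ge> 2"
  shows "inj_on (alt_sum Q n) {..n}"
proof (rule inj_onI)
  fix a b assume ab: "a \<in> {..n}" "b \<in> {..n}" "alt_sum Q n a = alt_sum Q n b"
  then have "(-1) ^ a * Q ^ (Suc n - a) = (-1) ^ b * Q ^ (Suc n - b)"
    using alt_sum_closed_form[of a n Q] alt_sum_closed_form[of b n Q] by simp
  then have "\<bar>(-1) ^ a * Q ^ (Suc n - a)\<bar> = \<bar>(-1) ^ b * Q ^ (Suc n - b)\<bar>"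
    by simp
  then have "Q ^ (Suc n - a) = Q ^ (Suc n - b)"
    using assms by (simp add: abs_mult power_abs)
  then have "Suc n - a = Suc n - b"
    using assms by (intro power_inject_exp[THEN iffD1]) auto
  then show "a = b" using ab by auto
qed

lemma alt_sum_two:
  assumes "n \<ge> 1"
  shows "alt_sum Q n 2 = Q ^ (n - 1) * (Q - 1)"
proof -
  obtain m where "n = Suc m" using assms by (cases n) auto
  then show ?thesis by (simp add: alt_sum_def numeral_2_eq_2 algebra_simps)
qed

lemma alt_sum_two_le:
  assumes "Q \<ge> 2" and "1 \<le> r" and "r \<le> n" and "2 \<le> n"
  shows "alt_sum Q n 2 \<le> alt_sum Q n r"
proof -
  have "(-1) ^ r * Q ^ (Suc n - r) \<le> Q ^ (Suc n - 2)"
  proof (cases "r = 1")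
    case True
    have "- (Q ^ n) \<le> 0" "0 \<le> Q ^ (n - 1)"
      using assms(1) by auto
    then have "- (Q ^ n) \<le> Q ^ (n - 1)"
      by linarith
    then show ?thesis using True by simp
  next
    case False
    then have "Q ^ (Suc n - r) \<le> Q ^ (Suc n - 2)"
      using assms by (intro power_increasing) auto
    moreover have "(-1) ^ r * Q ^ (Suc n - r) \<le> Q ^ (Suc n - r)"
      using assms(1) by (cases "even r") auto
    ultimately show ?thesis by linarith
  qed
  then have "(Q + 1) * alt_sum Q n 2 \<le> (Q + 1) * alt_sum Q n r"
    using alt_sum_closed_form[of r n Q] alt_sum_closed_form[of 2 n Q] assms by simp
  then show ?thesis
    using assms(1) by simp
qed

text \<open>
  Induction on the number of variables. A new variable with coefficient zero is free and
  multiplies the count by \<open>q - 1\<close>. A new variable with non-zero coefficient makes the extended form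
  vanish for exactly one value, and that value is allowed, i.e. non-zero, iff the old form does
  not vanish; so the new count is the number of all points minus the old count.
\<close>

lemma card_nonzero_linear_form:
  fixes c :: "'m \<Rightarrow> 'k::{field,finite}"
  assumes "finite M"
  shows "int (card {y \<in> M \<rightarrow>\<^sub>E (UNIV - {0}). (\<Sum>m\<in>M. c m * y m) \<noteq> 0})
       = alt_sum (int (CARD('k) - 1)) (card M) (card {m \<in> M. c m \<noteq> 0})"
  using assms
proof (induction M)
  case empty
  then show ?case by (simp add: alt_sum_def)
next
  case (insert a M)
  let ?Q = "CARD('k) - 1" and ?U = "UNIV - {0::'k}"
  define L where "L y = (\<Sum>m\<in>M. c m * y m)" for y :: "'m \<Rightarrow> 'k"
  define N where "N = {y \<in> M \<rightarrow>\<^sub>E ?U. L y \<noteq> 0}"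
  define N' where "N' = {y \<in> insert a M \<rightarrow>\<^sub>E ?U. c a * y a + L y \<noteq> 0}"
  define r where "r = card {m \<in> M. c m \<noteq> 0}"
  have L_upd [simp]: "L (y(a := b)) = L y" for y b
    unfolding L_def using insert.hyps by (intro sum.cong) auto
  have Q: "card ?U = ?Q"
    by (simp add: card_Diff_subset)
  have fin: "finite (X \<rightarrow>\<^sub>E ?U)" if "finite X" for X :: "'m set"
    using that by (intro finite_PiE) auto
  have IH: "int (card N) = alt_sum (int ?Q) (card M) r"
    using insert.IH by (simp add: N_def L_def r_def)
  have r: "r \<le> card M"
    unfolding r_def using insert.hyps by (intro card_mono) auto
  define r' where "r' = card {m \<in> insert a M. c m \<noteq> 0}"
  have supp: "r' = (if c a = 0 then r else Suc r)"
  proof -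
    have "{m \<in> insert a M. c m \<noteq> 0}
        = (if c a = 0 then {m \<in> M. c m \<noteq> 0} else insert a {m \<in> M. c m \<noteq> 0})"
      by auto
    then show ?thesis
      using insert.hyps by (simp add: r_def r'_def)
  qed
  have "int (card N') = alt_sum (int ?Q) (Suc (card M)) r'"
  proof (cases "c a = 0")
    case True
    have "N' = (\<lambda>(b, y). y(a := b)) ` (?U \<times> N)"
    proof (intro equalityI subsetI)
      fix z assume z: "z \<in> N'"
      then obtain b y where bz: "b \<in> ?U" "y \<in> M \<rightarrow>\<^sub>E ?U" "z = y(a := b)"
        unfolding N'_def PiE_insert_eq by auto
      then have "y \<in> N"
        using z True by (simp add: N'_def N_def)
      then show "z \<in> (\<lambda>(b, y). y(a := b)) ` (?U \<times> N)"
        using bz by (intro image_eqI[of _ _ "(b, y)"]) auto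
    next
      fix z assume "z \<in> (\<lambda>(b, y). y(a := b)) ` (?U \<times> N)"
      then show "z \<in> N'"
        using True by (auto simp: N'_def N_def PiE_insert_eq)
    qed
    moreover have "inj_on (\<lambda>(b, y). y(a := b)) (?U \<times> N)"
      using inj_combinator[OF insert.hyps(2), of "\<lambda>_. ?U"]
      by (rule inj_on_subset) (auto simp: N_def)
    ultimately have "card N' = ?Q * card N"
      by (simp add: card_image card_cartesian_product Q)
    then show ?thesis
      using True alt_sum_Suc[OF r, of "int ?Q"] by (simp add: IH supp)
  next
    case False
    define Z where "Z = {y \<in> insert a M \<rightarrow>\<^sub>E ?U. c a * y a + L y = 0}"
    \<comment> \<open>\<open>- L y / c a\<close> is the one value of the new variable at which the extended form vanishes.\<close>
    have "bij_betw (\<lambda>y. y(a := - L y / c a)) N Z"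
    proof (rule bij_betw_byWitness[where f' = "\<lambda>y. y(a := undefined)"])
      show "\<forall>y\<in>N. (y(a := - L y / c a))(a := undefined) = y"
        using insert.hyps(2) by (auto simp: N_def PiE_def extensional_def fun_eq_iff)
      show "\<forall>y\<in>Z. (y(a := undefined))(a := - L (y(a := undefined)) / c a) = y"
        using False by (auto simp: Z_def field_simps neg_eq_iff_add_eq_0 fun_eq_iff)
      show "(\<lambda>y. y(a := - L y / c a)) ` N \<subseteq> Z"
        using False by (auto simp: N_def Z_def PiE_def extensional_def split: if_splits)
      show "(\<lambda>y. y(a := undefined)) ` Z \<subseteq> N"
        using False insert.hyps(2) by (auto simp: N_def Z_def PiE_def extensional_def split: if_splits)
    qed
    then have "card Z = card N"
      using bij_betw_same_card by metis
    moreover have "card N' + card Z = card (insert a M \<rightarrow>\<^sub>E ?U)"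
      by (subst card_Un_disjoint[symmetric])
        (auto simp: N'_def Z_def fin insert.hyps intro!: arg_cong[of _ _ card])
    moreover have "card (insert a M \<rightarrow>\<^sub>E ?U) = ?Q ^ Suc (card M)"
      using insert.hyps by (simp add: card_PiE Q)
    ultimately have "int (card N') = int ?Q ^ Suc (card M) - int (card N)"
      by (metis add_diff_cancel_right' of_nat_add of_nat_power)
    then show ?thesis
      using False alt_sum_Suc_Suc[of "int ?Q" "card M" r] by (simp add: IH supp)
  qed
  then show ?case
    using insert.hyps by (simp add: N'_def L_def r'_def)
qed

section \<open>Polynomials supported on the edge monomials\<close>

lemma edge_space_eq:
  "(edge_space G :: ('v, 'k::field) mpoly set) = {f. Poly_Mapping.keys f \<subseteq> edge_exponent ` parcs G}"
proof -
  interpret vector_space "mpoly_scale :: 'k \<Rightarrow> ('v, 'k) mpoly \<Rightarrow> ('v, 'k) mpoly"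
    by (rule vector_space_mpoly_scale)
  let ?M = "edge_exponent ` parcs G"
  have lookup_scale: "Poly_Mapping.lookup (mpoly_scale c f) m = c * Poly_Mapping.lookup f m"
    for c :: 'k and f :: "('v, 'k) mpoly" and m
    by (simp add: mpoly_scale_def map.rep_eq when_def flip: mult_map_scale_conv_mult)
  have "subspace {f :: ('v, 'k) mpoly. Poly_Mapping.keys f \<subseteq> ?M}"
  proof (rule subspaceI)
    show "0 \<in> {f :: ('v, 'k) mpoly. Poly_Mapping.keys f \<subseteq> ?M}"
      by simp
  next
    fix f g :: "('v, 'k) mpoly"
    assume "f \<in> {f. Poly_Mapping.keys f \<subseteq> ?M}" "g \<in> {f. Poly_Mapping.keys f \<subseteq> ?M}"
    then show "f + g \<in> {f. Poly_Mapping.keys f \<subseteq> ?M}"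
      using Poly_Mapping.keys_add[of f g] by blast
  next
    fix c and f :: "('v, 'k) mpoly"
    assume "f \<in> {f. Poly_Mapping.keys f \<subseteq> ?M}"
    moreover have "Poly_Mapping.keys (mpoly_scale c f) \<subseteq> Poly_Mapping.keys f"
      by (auto simp: in_keys_iff lookup_scale)
    ultimately show "mpoly_scale c f \<in> {f. Poly_Mapping.keys f \<subseteq> ?M}"
      by blast
  qed
  then have "span (edge_monomial ` parcs G) \<subseteq> {f :: ('v, 'k) mpoly. Poly_Mapping.keys f \<subseteq> ?M}"
    by (intro span_minimal) (auto simp: edge_monomial_def)
  moreover have "f \<in> span (edge_monomial ` parcs G)"
    if f: "Poly_Mapping.keys f \<subseteq> ?M" for f :: "('v, 'k) mpoly"
  proof -
    have "Poly_Mapping.lookup f m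
        = (\<Sum>n\<in>Poly_Mapping.keys f. Poly_Mapping.lookup (mpoly_scale (Poly_Mapping.lookup f n) (Poly_Mapping.single n 1)) m)"
      for m
    proof (cases "m \<in> Poly_Mapping.keys f")
      case True
      then show ?thesis
        by (subst sum.remove[of _ m]) (auto simp: lookup_scale lookup_single when_def)
    next
      case False
      then show ?thesis
        by (auto simp: lookup_scale lookup_single when_def in_keys_iff intro!: sum.neutral)
    qed
    from this[folded lookup_sum] have "f = (\<Sum>n\<in>Poly_Mapping.keys f. mpoly_scale (Poly_Mapping.lookup f n) (Poly_Mapping.single n 1))"
      by (rule poly_mapping_eqI)
    also have "\<dots> \<in> span (edge_monomial ` parcs G)"
    proof (intro span_sum span_scale span_base)
      fix n assume "n \<in> Poly_Mapping.keys f"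
      then obtain e where "e \<in> parcs G" "n = edge_exponent e"
        using f by blast
      then show "Poly_Mapping.single n 1 \<in> (edge_monomial ` parcs G :: ('v, 'k) mpoly set)"
        by (auto simp: edge_monomial_def)
    qed
    finally show ?thesis .
  qed
  ultimately show ?thesis
    unfolding edge_space_def by blast
qed

lemma card_poly_mapping_keys_eq:
  assumes "finite A"
  shows "card {f :: 'm \<Rightarrow>\<^sub>0 'k::{zero,finite}. Poly_Mapping.keys f = A} = (CARD('k) - 1) ^ card A"
proof -
  let ?U = "UNIV - {0 :: 'k}"
  define F where "F = {f :: 'm \<Rightarrow>\<^sub>0 'k. Poly_Mapping.keys f = A}"
  define ext where "ext y m = (if m \<in> A then y m else 0)" for y :: "'m \<Rightarrow> 'k" and m
  have lookup_ext: "Poly_Mapping.lookup (Abs_poly_mapping (ext y)) = ext y" for y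
    by (rule lookup_Abs_poly_mapping, rule finite_subset[OF _ assms]) (auto simp: ext_def)
  have "bij_betw (\<lambda>f. restrict (Poly_Mapping.lookup f) A) F (A \<rightarrow>\<^sub>E ?U)"
  proof (rule bij_betw_byWitness[where f' = "\<lambda>y. Abs_poly_mapping (ext y)"])
    show "\<forall>f\<in>F. Abs_poly_mapping (ext (restrict (Poly_Mapping.lookup f) A)) = f"
    proof
      fix f assume "f \<in> F"
      then have "Poly_Mapping.lookup f m = 0" if "m \<notin> A" for m
        using that by (auto simp: F_def in_keys_iff)
      then show "Abs_poly_mapping (ext (restrict (Poly_Mapping.lookup f) A)) = f"
        by (intro poly_mapping_eqI) (simp add: lookup_ext ext_def)
    qed
    show "\<forall>y\<in>A \<rightarrow>\<^sub>E ?U. restrict (Poly_Mapping.lookup (Abs_poly_mapping (ext y))) A = y"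
    proof
      fix y assume "y \<in> A \<rightarrow>\<^sub>E ?U"
      then show "restrict (Poly_Mapping.lookup (Abs_poly_mapping (ext y))) A = y"
        unfolding lookup_ext by (intro extensionalityI[of _ A]) (auto simp: ext_def PiE_def)
    qed
    show "(\<lambda>f. restrict (Poly_Mapping.lookup f) A) ` F \<subseteq> A \<rightarrow>\<^sub>E ?U"
      by (auto simp: F_def in_keys_iff)
    show "(\<lambda>y. Abs_poly_mapping (ext y)) ` (A \<rightarrow>\<^sub>E ?U) \<subseteq> F"
    proof (rule image_subsetI)
      fix y assume "y \<in> A \<rightarrow>\<^sub>E ?U"
      then have "ext y m \<noteq> 0 \<longleftrightarrow> m \<in> A" for m
        by (auto simp: ext_def PiE_def Pi_def)
      then have "Poly_Mapping.keys (Abs_poly_mapping (ext y)) = A"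
        by (intro set_eqI) (simp only: in_keys_iff lookup_ext)
      then show "Abs_poly_mapping (ext y) \<in> F"
        unfolding F_def by (rule CollectI)
    qed
  qed
  then have "card F = card (A \<rightarrow>\<^sub>E ?U)"
    by (rule bij_betw_same_card)
  then show ?thesis
    using assms by (simp add: F_def card_PiE card_Diff_subset)
qed

lemma finite_poly_mapping_keys_subset:
  assumes "finite M"
  shows "finite {f :: 'm \<Rightarrow>\<^sub>0 'k::{zero,finite}. Poly_Mapping.keys f \<subseteq> M}"
proof (rule inj_on_finite)
  show "inj_on (\<lambda>f. restrict (Poly_Mapping.lookup f) M) {f :: 'm \<Rightarrow>\<^sub>0 'k. Poly_Mapping.keys f \<subseteq> M}"
  proof (rule inj_onI, rule poly_mapping_eqI)
    fix f g :: "'m \<Rightarrow>\<^sub>0 'k" and m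
    assume *: "f \<in> {f. Poly_Mapping.keys f \<subseteq> M}" "g \<in> {f. Poly_Mapping.keys f \<subseteq> M}"
      and "restrict (Poly_Mapping.lookup f) M = restrict (Poly_Mapping.lookup g) M"
    then show "Poly_Mapping.lookup f m = Poly_Mapping.lookup g m"
      by (cases "m \<in> M") (metis restrict_apply', metis (no_types) in_keys_iff mem_Collect_eq subsetD)
  qed
  show "finite (M \<rightarrow>\<^sub>E (UNIV :: 'k set))"
    using assms by (intro finite_PiE) auto
  show "(\<lambda>f. restrict (Poly_Mapping.lookup f) M) ` {f :: 'm \<Rightarrow>\<^sub>0 'k. Poly_Mapping.keys f \<subseteq> M}
      \<subseteq> M \<rightarrow>\<^sub>E UNIV"
    by (intro image_subsetI restrict_PiE_iff[THEN iffD2]) simp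
qed

text \<open>
  Choose the support, then a non-zero coefficient for each of its elements.
\<close>

lemma card_poly_mapping_card_keys:
  assumes "finite M"
  shows "card {f :: 'm \<Rightarrow>\<^sub>0 'k::{zero,finite}. Poly_Mapping.keys f \<subseteq> M \<and> card (Poly_Mapping.keys f) = r}
       = (card M choose r) * (CARD('k) - 1) ^ r"
proof -
  define F where "F A = {f :: 'm \<Rightarrow>\<^sub>0 'k. Poly_Mapping.keys f = A}" for A
  define R where "R = {A. A \<subseteq> M \<and> card A = r}"
  have finR: "finite R"
    using assms by (simp add: R_def)
  have "{f :: 'm \<Rightarrow>\<^sub>0 'k. Poly_Mapping.keys f \<subseteq> M \<and> card (Poly_Mapping.keys f) = r} = (\<Union>A\<in>R. F A)"
    by (auto simp: F_def R_def)
  also have "card \<dots> = (\<Sum>A\<in>R. card (F A))"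
  proof (rule card_UN_disjoint[OF finR])
    show "\<forall>A\<in>R. finite (F A)"
    proof
      fix A assume "A \<in> R"
      then have "F A \<subseteq> {f. Poly_Mapping.keys f \<subseteq> M}"
        by (auto simp: F_def R_def)
      then show "finite (F A)"
        by (rule finite_subset) (rule finite_poly_mapping_keys_subset[OF assms])
    qed
    show "\<forall>A\<in>R. \<forall>B\<in>R. A \<noteq> B \<longrightarrow> F A \<inter> F B = {}"
      by (auto simp: F_def)
  qed
  also have "\<dots> = (\<Sum>A\<in>R. (CARD('k) - 1) ^ r)"
    using assms by (intro sum.cong)
      (auto simp: F_def R_def card_poly_mapping_keys_eq dest: finite_subset)
  also have "\<dots> = (card M choose r) * (CARD('k) - 1) ^ r"
    using n_subsets[OF assms, of r] by (simp add: R_def)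
  finally show ?thesis .
qed

section \<open>Weights of codewords\<close>

lemma mpoly_eval_superset:
  assumes "finite M" and "Poly_Mapping.keys f \<subseteq> M"
  shows "mpoly_eval f P = (\<Sum>m\<in>M. Poly_Mapping.lookup f m * monomial_value P m)"
  unfolding mpoly_eval_def monomial_value_def using assms
  by (intro sum.mono_neutral_left) (auto simp: in_keys_iff)

text \<open>
  The torus is partitioned into the fibres of the map sending a point to its vector of edge
  monomial values. On a fibre \<open>f\<close> is constant, its value being a linear form in that vector, and
  each fibre has \<open>q - 1\<close> points. This factor turns \<open>alt_sum\<close> for the \<open>s - 1\<close> edges into \<open>alt_sum\<close> for
  the \<open>s\<close> vertices.
\<close>

lemma card_nonvanishing:
  fixes f :: "('v, 'k::{field,finite}) mpoly"
  assumes "tree_graph G" and "f \<in> edge_space G"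
  shows "int (card {P \<in> torus G. mpoly_eval f P \<noteq> 0})
       = alt_sum (int (CARD('k) - 1)) (card (pverts G)) (card (Poly_Mapping.keys f))"
proof -
  let ?U = "UNIV - {0 :: 'k}" and ?Q = "CARD('k) - 1"
  have G: "pair_graph G" "connected (with_proj G)"
    using assms(1) by (auto simp: tree_graph_def)
  define M where "M = edge_exponent ` parcs G"
  have M: "M = edges_within G (pverts G)"
    using edges_within_pverts[OF G(1)] by (simp add: M_def)
  have grown: "grown G (pverts G)"
    using grown_pverts G by blast
  have finM: "finite M" and cardM: "Suc (card M) = card (pverts G)" and finV: "finite (pverts G)"
    using tree_card_edges[OF assms(1)] by (auto simp: M_def)
  have keys: "Poly_Mapping.keys f \<subseteq> M"
    using assms(2) by (simp add: edge_space_eq M_def)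
  define L where "L y = (\<Sum>m\<in>M. Poly_Mapping.lookup f m * y m)" for y
  define Y where "Y = {y \<in> M \<rightarrow>\<^sub>E ?U. L y \<noteq> 0}"
  define fibre where "fibre y = {P \<in> pverts G \<rightarrow>\<^sub>E ?U. \<forall>m\<in>M. monomial_value P m = y m}" for y
  have eval: "mpoly_eval f P = L (monomial_value P)" for P
    unfolding L_def using mpoly_eval_superset[OF finM keys] .
  have L_cong: "L y = L y'" if "\<And>m. m \<in> M \<Longrightarrow> y m = y' m" for y y'
    unfolding L_def using that by (intro sum.cong) auto
  have nz: "monomial_value P m \<noteq> 0" if P: "P \<in> pverts G \<rightarrow>\<^sub>E ?U" and m: "m \<in> M"
    for P :: "'v \<Rightarrow> 'k" and m
  proof -
    have "P x \<noteq> 0" if "x \<in> Poly_Mapping.keys m" for x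
      using P keys_edges_within[of m G] m that by (auto simp: M PiE_def Pi_def)
    then show ?thesis
      by (simp add: monomial_value_def)
  qed
  have "{P \<in> torus G. mpoly_eval f P \<noteq> 0} = (\<Union>y\<in>Y. fibre y)"
  proof (intro equalityI subsetI)
    fix P assume P: "P \<in> {P \<in> torus G. mpoly_eval f P \<noteq> 0}"
    then have PT: "P \<in> pverts G \<rightarrow>\<^sub>E ?U" and "L (monomial_value P) \<noteq> 0"
      by (auto simp: torus_def eval)
    moreover have "L (restrict (monomial_value P) M) = L (monomial_value P)"
      by (rule L_cong) simp
    ultimately have "restrict (monomial_value P) M \<in> Y"
      using nz[OF PT] by (auto simp: Y_def)
    moreover have "P \<in> fibre (restrict (monomial_value P) M)"
      using PT by (auto simp: fibre_def)
    ultimately show "P \<in> (\<Union>y\<in>Y. fibre y)"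
      by blast
  next
    fix P assume "P \<in> (\<Union>y\<in>Y. fibre y)"
    then obtain y where "L y \<noteq> 0" and P: "P \<in> pverts G \<rightarrow>\<^sub>E ?U" "\<forall>m\<in>M. monomial_value P m = y m"
      by (auto simp: Y_def fibre_def)
    then show "P \<in> {P \<in> torus G. mpoly_eval f P \<noteq> 0}"
      using L_cong[of "monomial_value P" y] by (auto simp: torus_def eval)
  qed
  also have "card \<dots> = (\<Sum>y\<in>Y. card (fibre y))"
  proof (rule card_UN_disjoint)
    show "finite Y"
      using finite_PiE[OF finM, of "\<lambda>_. ?U"] by (simp add: Y_def)
    show "\<forall>y\<in>Y. finite (fibre y)"
      using finite_PiE[OF finV, of "\<lambda>_. ?U"] by (simp add: fibre_def)
    show "\<forall>y\<in>Y. \<forall>z\<in>Y. y \<noteq> z \<longrightarrow> fibre y \<inter> fibre z = {}"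
    proof (intro ballI impI)
      fix y z assume "y \<in> Y" "z \<in> Y" "y \<noteq> z"
      then obtain m where "m \<in> M" "y m \<noteq> z m"
        unfolding Y_def by (metis (no_types, lifting) PiE_ext mem_Collect_eq)
      then show "fibre y \<inter> fibre z = {}"
        by (auto simp: fibre_def)
    qed
  qed
  also have "\<dots> = (\<Sum>y\<in>Y. ?Q)"
  proof (rule sum.cong)
    fix y assume "y \<in> Y"
    then show "card (fibre y) = ?Q"
      unfolding fibre_def M
      by (intro card_monomial_fibre assms(1) grown) (auto simp: Y_def M PiE_def Pi_def)
  qed simp
  finally have card: "int (card {P \<in> torus G. mpoly_eval f P \<noteq> 0}) = int ?Q * int (card Y)"
    by simp
  have "{m \<in> M. Poly_Mapping.lookup f m \<noteq> 0} = Poly_Mapping.keys f"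
    using keys by (auto simp: in_keys_iff)
  then have "int (card Y) = alt_sum (int ?Q) (card M) (card (Poly_Mapping.keys f))"
    unfolding Y_def L_def using card_nonzero_linear_form[OF finM, of "Poly_Mapping.lookup f"] by simp
  moreover have "card (Poly_Mapping.keys f) \<le> card M"
    using keys finM by (rule card_mono[rotated])
  ultimately show ?thesis
    unfolding card cardM[symmetric] using alt_sum_Suc by metis
qed

lemma hamming_weight_evaluation_word:
  assumes "distinct Ps" and "set Ps = torus G"
  shows "hamming_weight (evaluation_word Ps f) = card {P \<in> torus G. mpoly_eval f P \<noteq> 0}"
proof -
  have "bij_betw ((!) Ps) {i. i < length (evaluation_word Ps f) \<and> evaluation_word Ps f ! i \<noteq> 0}
      {P \<in> torus G. mpoly_eval f P \<noteq> 0}"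
    unfolding bij_betw_def
  proof
    show "inj_on ((!) Ps) {i. i < length (evaluation_word Ps f) \<and> evaluation_word Ps f ! i \<noteq> 0}"
      using assms(1) by (auto simp: evaluation_word_def inj_on_def nth_eq_iff_index_eq)
    show "(!) Ps ` {i. i < length (evaluation_word Ps f) \<and> evaluation_word Ps f ! i \<noteq> 0}
        = {P \<in> torus G. mpoly_eval f P \<noteq> 0}"
      unfolding assms(2)[symmetric] by (auto simp: evaluation_word_def in_set_conv_nth)
  qed
  then show ?thesis
    unfolding hamming_weight_def by (rule bij_betw_same_card)
qed

lemma num_terms_eq_card_keys:
  assumes "f \<in> edge_space G"
  shows "num_terms G f = card (Poly_Mapping.keys f)"
  unfolding num_terms_def using assms
  by (intro arg_cong[of _ _ card]) (auto simp: edge_space_eq in_keys_iff)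

section \<open>The weight distribution\<close>

text \<open>
  Two polynomials with the same codeword differ by an element of \<open>KE(G)\<close> of weight 0. Distinct
  numbers of terms give distinct weights, so this difference has as many terms as the zero
  polynomial.
\<close>

lemma inj_on_evaluation_word:
  fixes G :: "'v pair_pre_digraph" and Ps :: "('v \<Rightarrow> 'k::{field,finite}) list"
  assumes "tree_graph G" and "CARD('k) > 2" and "set Ps = torus G"
  shows "inj_on (evaluation_word Ps) (edge_space G)"
proof (rule inj_onI)
  fix f g :: "('v, 'k) mpoly"
  assume f: "f \<in> edge_space G" and g: "g \<in> edge_space G"
    and eq: "evaluation_word Ps f = evaluation_word Ps g"
  let ?M = "edge_exponent ` parcs G" and ?n = "card (pverts G)" and ?Q = "int (CARD('k) - 1)"
  have fin: "finite ?M" and card: "card ?M < ?n"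
    using tree_card_edges[OF assms(1)] by auto
  have keys: "Poly_Mapping.keys (f - g) \<subseteq> ?M"
    using f g Poly_Mapping.keys_diff[of f g] by (auto simp: edge_space_eq)
  then have diff: "f - g \<in> edge_space G"
    by (simp add: edge_space_eq)
  have "mpoly_eval (f - g) P = mpoly_eval f P - mpoly_eval g P" for P
    using f g keys by (simp add: edge_space_eq mpoly_eval_superset[OF fin] lookup_minus
        left_diff_distrib sum_subtractf)
  moreover have "mpoly_eval f P = mpoly_eval g P" if "P \<in> torus G" for P
    using eq that assms(3) by (auto simp: evaluation_word_def)
  ultimately have "{P \<in> torus G. mpoly_eval (f - g) P \<noteq> 0} = {}"
    by auto
  then have "alt_sum ?Q ?n (card (Poly_Mapping.keys (f - g))) = alt_sum ?Q ?n 0"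
    using card_nonvanishing[OF assms(1) diff] by (simp only: card.empty of_nat_0 alt_sum_0)
  moreover have "card (Poly_Mapping.keys (f - g)) \<le> ?n"
    using card_mono[OF fin keys] card by simp
  ultimately have "card (Poly_Mapping.keys (f - g)) = 0"
    using inj_on_alt_sum[of ?Q ?n] assms(2) by (simp add: inj_on_def)
  then show "f = g"
    by simp
qed

theorem theorem2p4:
  fixes G :: "'v pair_pre_digraph"
    and Ps :: "('v \<Rightarrow> 'k::{field,finite}) list"
    and q s :: nat
  assumes "q = CARD('k)" and "q > 2"
    and "tree_graph G" and "s = card (pverts G)" and "s \<ge> 2"
    and "distinct Ps" and "set Ps = torus G"
  shows "(\<forall>r\<in>{1..s-1}.
            weight_count (edge_code G Ps) (nat (\<Sum>i<r. (-1) ^ i * (int q - 1) ^ (s - i)))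
              = ((s - 1) choose r) * (q - 1) ^ r)
       \<and> (\<forall>j\<in>{1..(q - 1) ^ s}.
            (\<forall>r\<in>{1..s-1}. int j \<noteq> (\<Sum>i<r. (-1) ^ i * (int q - 1) ^ (s - i)))
              \<longrightarrow> weight_count (edge_code G Ps) j = 0)
       \<and> (s \<ge> 3 \<longrightarrow>
            min_distance (edge_code G Ps) = (q - 1) ^ (s - 1) * (q - 2)
          \<and> int (min_distance (edge_code G Ps)) = (\<Sum>i<2. (-1) ^ i * (int q - 1) ^ (s - i)))
       \<and> (\<forall>f\<in>edge_space G. num_terms G f = 2 \<longrightarrow>
            hamming_weight (evaluation_word Ps f) = min_distance (edge_code G Ps))"
proof -
  let ?E = "edge_space G :: ('v, 'k) mpoly set" and ?C = "edge_code G Ps"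
  let ?M = "edge_exponent ` parcs G"
  define Q where "Q = int q - 1"
  have Q: "Q \<ge> 2" "int (CARD('k) - 1) = Q"
    using assms(1,2) by (auto simp: Q_def)
  define w where "w = alt_sum Q s"
  define wt where "wt f = hamming_weight (evaluation_word Ps f)" for f :: "('v, 'k) mpoly"
  have w: "(\<Sum>i<r. (-1) ^ i * (int q - 1) ^ (s - i)) = w r" for r
    by (simp add: w_def alt_sum_def Q_def)
  have finM: "finite ?M" and cardM: "card ?M = s - 1"
    using tree_card_edges[OF assms(3)] assms(4) by auto
  have terms: "num_terms G f \<le> s - 1" if "f \<in> ?E" for f
    using that card_mono[OF finM, of "Poly_Mapping.keys f"] cardM
    by (simp add: num_terms_eq_card_keys edge_space_eq)
  have wt: "int (wt f) = w (num_terms G f)" if "f \<in> ?E" for f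
    unfolding wt_def hamming_weight_evaluation_word[OF assms(6,7)]
    using that card_nonvanishing[OF assms(3) that]
    by (simp only: num_terms_eq_card_keys w_def assms(4) Q)
  have w_two: "w 2 = Q ^ (s - 1) * (Q - 1)"
    using alt_sum_two[of s Q] assms(5) by (simp add: w_def)
  then have w_two_pos: "w 2 > 0"
    using Q(1) by simp
  have w_two_le: "w 2 \<le> w r" if "1 \<le> r" "r \<le> s - 1" for r
    using alt_sum_two_le[OF Q(1), of r s] that assms(5) by (simp add: w_def)
  have w_inj: "w a = w b \<longleftrightarrow> a = b" if "a \<le> s - 1" "b \<le> s - 1" for a b
    using inj_on_alt_sum[OF Q(1), of s] that by (auto simp: w_def inj_on_def)
  \<comment> \<open>Codewords may be counted as polynomials, since evaluation is injective on \<open>KE(G)\<close>.\<close>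
  have count: "weight_count ?C j = card {f \<in> ?E. wt f = j}" for j
  proof -
    have "{c \<in> ?C. hamming_weight c = j} = evaluation_word Ps ` {f \<in> ?E. wt f = j}"
      by (auto simp: edge_code_def wt_def)
    moreover have "inj_on (evaluation_word Ps) {f \<in> ?E. wt f = j}"
      using inj_on_evaluation_word[OF assms(3) _ assms(7)] assms(1,2)
      by (auto intro: inj_on_subset)
    ultimately show ?thesis
      by (simp add: weight_count_def card_image)
  qed
  have count_w: "weight_count ?C (nat (w r)) = ((s - 1) choose r) * (q - 1) ^ r"
    if r: "1 \<le> r" "r \<le> s - 1" for r
  proof -
    have "wt f = nat (w r) \<longleftrightarrow> num_terms G f = r" if "f \<in> ?E" for f
      using wt[OF that] w_two_le[OF r] w_two_pos w_inj[OF terms[OF that] r(2)] by linarith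
    then have "{f \<in> ?E. wt f = nat (w r)}
        = {f. Poly_Mapping.keys f \<subseteq> ?M \<and> card (Poly_Mapping.keys f) = r}"
      by (auto simp: num_terms_eq_card_keys edge_space_eq)
    then show ?thesis
      unfolding count using card_poly_mapping_card_keys[OF finM, of r, where 'k = 'k] cardM assms(1)
      by simp
  qed
  have attained: "\<exists>r\<in>{1..s-1}. int j = w r" if j: "1 \<le> j" "weight_count ?C j \<noteq> 0" for j
  proof -
    obtain f where f: "f \<in> ?E" "wt f = j"
      using j(2) unfolding count by (metis (mono_tags, lifting) card.empty empty_Collect_eq)
    have "num_terms G f \<noteq> 0"
      using wt[OF f(1)] f(2) j(1) by (intro notI) (simp add: w_def)
    then show ?thesis
      using wt[OF f(1)] f terms[OF f(1)] by (intro bexI[of _ "num_terms G f"]) auto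
  qed
  have dist: "int (min_distance ?C) = w 2" if "s \<ge> 3"
  proof -
    have "min_distance ?C = nat (w 2)"
      unfolding min_distance_def
    proof (rule Least_equality)
      show "1 \<le> nat (w 2) \<and> weight_count ?C (nat (w 2)) \<noteq> 0"
        using count_w[of 2] that w_two_pos assms(2) by auto
    next
      fix i assume "1 \<le> i \<and> weight_count ?C i \<noteq> 0"
      then obtain r where "r \<in> {1..s-1}" "int i = w r"
        using attained by blast
      then show "nat (w 2) \<le> i"
        using w_two_le[of r] by simp
    qed
    then show ?thesis
      using w_two_pos by simp
  qed
  have "int ((q - 1) ^ (s - 1) * (q - 2)) = w 2"
    using assms(2) by (simp add: w_two Q_def of_nat_diff)
  then have dist_eq: "min_distance ?C = (q - 1) ^ (s - 1) * (q - 2)" if "s \<ge> 3"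
    using dist[OF that] by (metis of_nat_eq_iff)
  have two: "wt f = min_distance ?C" if "f \<in> ?E" "num_terms G f = 2" for f
  proof -
    have "s \<ge> 3"
      using terms[OF that(1)] that(2) by simp
    then show ?thesis
      using wt[OF that(1)] that(2) dist by simp
  qed
  show ?thesis
    unfolding w
  proof (intro conjI ballI impI)
    fix r assume "r \<in> {1..s - 1}"
    then show "weight_count ?C (nat (w r)) = (s - 1 choose r) * (q - 1) ^ r"
      using count_w by simp
  next
    fix j assume "j \<in> {1..(q - 1) ^ s}" and "\<forall>r\<in>{1..s - 1}. int j \<noteq> w r"
    then show "weight_count ?C j = 0"
      using attained[of j] by (metis atLeastAtMost_iff)
  next
    fix f :: "('v, 'k) mpoly"
    assume "f \<in> ?E" and "num_terms G f = 2"
    then show "hamming_weight (evaluation_word Ps f) = min_distance ?C"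
      using two by (simp only: wt_def)
  qed (use dist dist_eq in blast)+
qed

end
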